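(* Let $N\ge1$ and, for $0\le k\le N-1$, let $f(k,\cdot,\cdot):\mathbb{R}^n\times\mathbb{R}^m\to\mathbb{R}^n$ and $\bar L(k,\cdot,\cdot):\mathbb{R}^n\times\mathbb{R}^m\to\mathbb{R}$ be smooth functions. Put $$\bar H(k,q_k,p_{k+1},u_k)=p_{k+1}f(k,q_k,u_k)-\bar L(k,q_k,u_k),$$ and assume that $$\det\left(\frac{\partial^2\bar H}{\partial u_a\partial u_b}\right)_{1\le a,b\le m}\neq0 .$$ Then for every $k$ with $0\le k\le N-1$, along the solutions of $$q_{k+1}=\frac{\partial\bar H}{\partial p}(k,q_k,p_{k+1},u_k),\qquad p_k=\frac{\partial\bar H}{\partial q}(k,q_k,p_{k+1},u_k),\qquad 0=\frac{\partial\bar H}{\partial u}(k,q_k,p_{k+1},u_k)$$ (that is, after pulling back to the submanifold of points $(q_k,p_k,u_k,q_{k+1},p_{k+1})$ satisfying these three equations) one has $$dp_k\wedge dq_k=dp_{k+1}\wedge dq_{k+1}.$$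
   Context: These three equations are the necessary conditions for the discrete optimal control problem of minimizing $J=\bar S(N,q_N)+\sum_{k=0}^{N-1}\bar L(k,q_k,u_k)$ subject to $q_{k+1}=f(k,q_k,u_k)$ with $q_0$ given. Here $q_k=(q_k^A)\in\mathbb{R}^n$ are states, $u_k=(u_k^a)\in\mathbb{R}^m$ controls, and $p_k=((p_k)_A)\in\mathbb{R}^n$ co-states (Lagrange multipliers). Notation: $p_{k+1}f=\sum_A(p_{k+1})_Af^A$ and $dp_k\wedge dq_k=\sum_{A=1}^n d(p_k)_A\wedge dq_k^A$. $\partial\bar H/\partial q$, $\partial\bar H/\partial p$, $\partial\bar H/\partial u$ are the derivatives with respect to the arguments $q_k$, $p_{k+1}$, $u_k$ respectively. By the determinant condition, the set of solutions of the three equations for fixed $k$ is a $2n$-dimensional submanifold locally parametrized by $(q_k,p_{k+1})$, with $u_k$ locally a function of $(k,q_k,p_{k+1})$. *)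

theory Defs
  imports "HOL-Analysis.Analysis"
begin

(* Only meant for open S; on a finite-dimensional domain, continuity of all iterated
   directional derivatives is the usual C^r condition. *)
primrec Ck_on :: "nat \<Rightarrow> ('a::euclidean_space \<Rightarrow> 'b::euclidean_space) \<Rightarrow> 'a set \<Rightarrow> bool" where
  "Ck_on 0 f S \<longleftrightarrow> continuous_on S f"
| "Ck_on (Suc r) f S \<longleftrightarrow>
     (\<forall>x\<in>S. f differentiable (at x)) \<and> (\<forall>v. Ck_on r (\<lambda>x. frechet_derivative f (at x) v) S)"

definition smooth_on :: "'a set \<Rightarrow> ('a::euclidean_space \<Rightarrow> 'b::euclidean_space) \<Rightarrow> bool" where
  "smooth_on S f \<longleftrightarrow> (\<forall>r. Ck_on r f S)"

definition partial :: "'i::finite \<Rightarrow> (real^'i \<Rightarrow> real) \<Rightarrow> real^'i \<Rightarrow> real" where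
  "partial i g x = frechet_derivative g (at x) (axis i 1)"

definition grad :: "(real^'i::finite \<Rightarrow> real) \<Rightarrow> real^'i \<Rightarrow> real^'i" where
  "grad g x = (\<chi> i. partial i g x)"

definition hessian :: "(real^'i::finite \<Rightarrow> real) \<Rightarrow> real^'i \<Rightarrow> real^'i^'i" where
  "hessian g x = (\<chi> a b. partial a (partial b g) x)"


(* Differential forms on a Euclidean space: a 1-form is a map (point, vector) to real,
   a 2-form a map (point, vector, vector) to real. *)
definition ext_d :: "('a::euclidean_space \<Rightarrow> real) \<Rightarrow> 'a \<Rightarrow> 'a \<Rightarrow> real" where
  "ext_d g x = frechet_derivative g (at x)"

definition wedge :: "('a \<Rightarrow> 'a \<Rightarrow> real) \<Rightarrow> ('a \<Rightarrow> 'a \<Rightarrow> real) \<Rightarrow> 'a \<Rightarrow> 'a \<Rightarrow> 'a \<Rightarrow> real" where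
  "wedge \<alpha> \<beta> x v w = \<alpha> x v * \<beta> x w - \<alpha> x w * \<beta> x v"

definition d_wedge_d ::
  "('a::euclidean_space \<Rightarrow> real^'n::finite) \<Rightarrow> ('a \<Rightarrow> real^'n) \<Rightarrow> 'a \<Rightarrow> 'a \<Rightarrow> 'a \<Rightarrow> real" where
  "d_wedge_d P Q x v w =
     (\<Sum>A\<in>UNIV. wedge (ext_d (\<lambda>y. P y $ A)) (ext_d (\<lambda>y. Q y $ A)) x v w)"


(* Embedded d-dimensional submanifold: locally the common zero set of DIM('a) - d smooth
   real functions whose differentials are linearly independent along the set. *)
definition smooth_submanifold :: "nat \<Rightarrow> 'a::euclidean_space set \<Rightarrow> bool" where
  "smooth_submanifold d M \<longleftrightarrow>
     (\<exists>c. d + c = DIM('a) \<and>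
       (\<forall>x\<in>M. \<exists>U (g :: nat \<Rightarrow> 'a \<Rightarrow> real). open U \<and> x \<in> U \<and>
          (\<forall>i<c. smooth_on U (g i)) \<and>
          M \<inter> U = {y \<in> U. \<forall>i<c. g i y = 0} \<and>
          (\<forall>y \<in> M \<inter> U. \<forall>a :: nat \<Rightarrow> real.
             (\<forall>v. (\<Sum>i<c. a i * ext_d (g i) y v) = 0) \<longrightarrow> (\<forall>i<c. a i = 0))))"

definition tangent_vectors :: "'a::euclidean_space set \<Rightarrow> 'a \<Rightarrow> 'a set" where
  "tangent_vectors M x =
     {v. \<exists>e>0. \<exists>\<gamma> :: real \<Rightarrow> 'a. smooth_on {-e<..<e} \<gamma> \<and> \<gamma> ` {-e<..<e} \<subseteq> M \<and>
           \<gamma> 0 = x \<and> (\<gamma> has_vector_derivative v) (at 0)}"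

(* Pullback of a 2-form along the inclusion of M, i.e. its restriction to tangent vectors;
   restrict makes equality of pullbacks mean equality at points of M on vectors tangent to M. *)
definition pullback_to ::
  "'a::euclidean_space set \<Rightarrow> ('a \<Rightarrow> 'a \<Rightarrow> 'a \<Rightarrow> real) \<Rightarrow> 'a \<Rightarrow> 'a \<Rightarrow> 'a \<Rightarrow> real" where
  "pullback_to M \<omega> =
     (\<lambda>x\<in>M. \<lambda>v\<in>tangent_vectors M x. \<lambda>w\<in>tangent_vectors M x. \<omega> x v w)"


definition Hbar ::
  "(nat \<Rightarrow> real^'n \<Rightarrow> real^'m \<Rightarrow> real^'n) \<Rightarrow> (nat \<Rightarrow> real^'n \<Rightarrow> real^'m \<Rightarrow> real) \<Rightarrow>
   nat \<Rightarrow> real^'n::finite \<Rightarrow> real^'n \<Rightarrow> real^'m::finite \<Rightarrow> real" where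
  "Hbar f L k q p' u = p' \<bullet> f k q u - L k q u"

(* Points are (q_k, p_k, u_k, q_{k+1}, p_{k+1}); primes denote the values at k+1. *)
type_synonym ('n, 'm) point = "(real^'n) \<times> (real^'n) \<times> (real^'m) \<times> (real^'n) \<times> (real^'n)"

definition solution_set ::
  "(nat \<Rightarrow> real^'n \<Rightarrow> real^'n \<Rightarrow> real^'m \<Rightarrow> real) \<Rightarrow> nat \<Rightarrow> ('n::finite, 'm::finite) point set" where
  "solution_set H k =
     {(q, p, u, q', p'). q' = grad (\<lambda>y. H k q y u) p' \<and>
                         p = grad (\<lambda>y. H k y p' u) q \<and>
                         0 = grad (\<lambda>y. H k q p' y) u}"

definition q_now :: "('n::finite, 'm::finite) point \<Rightarrow> real^'n" where
  "q_now = (\<lambda>(q, p, u, q', p'). q)"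

definition p_now :: "('n::finite, 'm::finite) point \<Rightarrow> real^'n" where
  "p_now = (\<lambda>(q, p, u, q', p'). p)"

definition q_next :: "('n::finite, 'm::finite) point \<Rightarrow> real^'n" where
  "q_next = (\<lambda>(q, p, u, q', p'). q')"

definition p_next :: "('n::finite, 'm::finite) point \<Rightarrow> real^'n" where
  "p_next = (\<lambda>(q, p, u, q', p'). p')"

end

theory Submission
  imports Defs
begin

text \<open>Write \<open>K (q, p', u)\<close> for the Hamiltonian at a fixed step. The three equations say that the
  differential of \<open>K\<close> at \<open>z = (q, p', u)\<close> is \<open>p dq + q' dp'\<close>, with no \<open>du\<close> component. Hence on the
  solution set \<open>p dq + q' dp' = dK\<close> is closed, and its exterior derivative
  \<open>dp \<and> dq + dq' \<and> dp' = 0\<close> is the claim.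

  Concretely, for \<open>w = (a, b, c)\<close> put \<open>defect K w = p \<bullet> a + q' \<bullet> b - DK(z) w\<close>. The solution set is the
  common zero set of these functions (\<open>solution_set_eq\<close>), so tangent vectors annihilate their
  differentials. For tangent vectors \<open>V\<close>, \<open>W\<close>, choosing as \<open>w\<close> the \<open>(q, p', u)\<close> part of \<open>W\<close> shows that
  \<open>D\<^sup>2K\<close> evaluated on the \<open>(q, p', u)\<close> parts of \<open>V\<close> and \<open>W\<close> is
  \<open>p(V) \<bullet> q(W) + q'(V) \<bullet> p'(W)\<close>. Its symmetry in \<open>V\<close> and \<open>W\<close> (\<open>second_derivative_symmetric\<close>) is the
  equality of the two 2-forms (\<open>d_wedge_d_solution_set\<close>).

  The determinant condition gives the manifold claim: the coordinates \<open>p\<close> and \<open>q'\<close> occur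
  linearly in \<open>defect\<close>, which disposes of \<open>a\<close> and \<open>b\<close> in a linear relation between the differentials,
  and the invertible Hessian in \<open>u\<close> disposes of \<open>c\<close>
  (\<open>smooth_submanifold_solution_set\<close>). This leaves \<open>2n + m\<close> independent equations in \<open>4n + m\<close>
  variables.\<close>

section \<open>Calculus of smooth functions\<close>

lemma frechet_derivative_eq: "(f has_derivative f') (at x) \<Longrightarrow> frechet_derivative f (at x) = f'"
  using frechet_derivative_at by metis

lemma smooth_on_UNIV_iff:
  "smooth_on UNIV f \<longleftrightarrow>
     (\<forall>x. f differentiable (at x)) \<and> (\<forall>v. smooth_on UNIV (\<lambda>x. frechet_derivative f (at x) v))"
    (is "?L \<longleftrightarrow> ?R")
proof
  assume ?L
  then have "Ck_on (Suc r) f UNIV" for r by (auto simp: smooth_on_def simp del: Ck_on.simps)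
  then show ?R by (auto simp: smooth_on_def)
next
  assume R: ?R
  have "Ck_on r f UNIV" for r
  proof (cases r)
    case 0
    have "continuous_on UNIV f"
      using R by (simp add: continuous_on_eq_continuous_at differentiable_imp_continuous_within)
    with 0 show ?thesis by simp
  qed (use R in \<open>auto simp: smooth_on_def\<close>)
  then show ?L by (simp add: smooth_on_def)
qed

lemma smooth_has_derivative:
  "smooth_on UNIV f \<Longrightarrow> (f has_derivative frechet_derivative f (at x)) (at x)"
  using smooth_on_UNIV_iff frechet_derivative_works by blast

lemma smooth_frechet_derivative:
  "smooth_on UNIV f \<Longrightarrow> smooth_on UNIV (\<lambda>x. frechet_derivative f (at x) v)"
  using smooth_on_UNIV_iff by blast

lemma linear_frechet_derivative: "linear (frechet_derivative f (at x))" if "smooth_on UNIV f"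
  using smooth_has_derivative[OF that] has_derivative_linear by blast

lemma Ck_on_const: "Ck_on r (\<lambda>x. c) UNIV"
  by (induction r arbitrary: c) auto

lemma smooth_bounded_linear:
  assumes "bounded_linear A"
  shows "smooth_on UNIV A"
proof -
  have D: "(A has_derivative A) (at x)" for x
    using assms by (rule bounded_linear_imp_has_derivative)
  show ?thesis
    by (subst smooth_on_UNIV_iff)
      (auto simp: frechet_derivative_eq[OF D] differentiable_def smooth_on_def Ck_on_const intro: D)
qed

lemma frechet_derivative_compose_affine:
  assumes A: "bounded_linear A" and f: "smooth_on UNIV f"
  shows "((\<lambda>x. f (c + A x)) has_derivative (\<lambda>v. frechet_derivative f (at (c + A x)) (A v))) (at x)"
    and "frechet_derivative (\<lambda>x. f (c + A x)) (at x) v = frechet_derivative f (at (c + A x)) (A v)"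
proof -
  have "((\<lambda>x. c + A x) has_derivative A) (at x)"
    using has_derivative_add[OF has_derivative_const bounded_linear_imp_has_derivative[OF A]]
    by simp
  from has_derivative_compose[OF this smooth_has_derivative[OF f]]
  show D: "((\<lambda>x. f (c + A x)) has_derivative (\<lambda>v. frechet_derivative f (at (c + A x)) (A v))) (at x)" .
  show "frechet_derivative (\<lambda>x. f (c + A x)) (at x) v = frechet_derivative f (at (c + A x)) (A v)"
    by (simp add: frechet_derivative_eq[OF D])
qed

text \<open>The derivative in a fixed direction is again a smooth function composed with the same affine
  map. This makes an induction on the order work when the function is left arbitrary and assumed
  smooth, rather than only \<open>C\<^sup>r\<close>; the product rule for \<open>smooth_inner\<close> is treated alike.\<close>

lemma smooth_compose_affine:
  assumes A: "bounded_linear A" and f: "smooth_on UNIV f"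
  shows "smooth_on UNIV (\<lambda>x. f (c + A x))"
proof -
  have "Ck_on r (\<lambda>x. f (c + A x)) UNIV" for r
    using f
  proof (induction r arbitrary: f)
    case 0
    then show ?case
      using has_derivative_continuous[OF frechet_derivative_compose_affine(1)[OF A 0]]
      by (auto simp: continuous_on_eq_continuous_at)
  next
    case (Suc r)
    show ?case
      using Suc.IH[OF smooth_frechet_derivative[OF Suc.prems]]
        frechet_derivative_compose_affine(1)[OF A Suc.prems]
      by (auto simp: frechet_derivative_compose_affine(2)[OF A Suc.prems] differentiable_def)
  qed
  then show ?thesis by (simp add: smooth_on_def)
qed

lemmas smooth_compose_linear = smooth_compose_affine[where c = 0, simplified]

lemma Ck_on_add:
  assumes "Ck_on r f UNIV" "Ck_on r g UNIV"
  shows "Ck_on r (\<lambda>x. f x + g x) UNIV"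
  using assms
proof (induction r arbitrary: f g)
  case 0
  then show ?case by (auto intro: continuous_intros)
next
  case (Suc r)
  have D: "((\<lambda>x. f x + g x) has_derivative
      (\<lambda>v. frechet_derivative f (at x) v + frechet_derivative g (at x) v)) (at x)" for x
    using Suc.prems by (auto intro!: has_derivative_add simp: frechet_derivative_works)
  show ?case
    using D Suc.IH Suc.prems by (auto simp: frechet_derivative_eq[OF D] differentiable_def)
qed

lemma smooth_inner:
  assumes f: "smooth_on UNIV f" and g: "smooth_on UNIV g"
  shows "smooth_on UNIV (\<lambda>x. f x \<bullet> g x)"
proof -
  have "Ck_on r (\<lambda>x. f x \<bullet> g x) UNIV" for r
    using f g
  proof (induction r arbitrary: f g)
    case 0
    then have "continuous_on UNIV f" "continuous_on UNIV g"
      by (metis Ck_on.simps(1) smooth_on_def)+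
    then show ?case by (auto intro: continuous_intros)
  next
    case (Suc r)
    note f = Suc.prems(1) and g = Suc.prems(2)
    have D: "((\<lambda>x. f x \<bullet> g x) has_derivative
        (\<lambda>v. f x \<bullet> frechet_derivative g (at x) v + frechet_derivative f (at x) v \<bullet> g x)) (at x)"
      for x
      using has_derivative_inner[OF smooth_has_derivative[OF f] smooth_has_derivative[OF g]] .
    show ?case
      using D Ck_on_add[OF Suc.IH[OF f smooth_frechet_derivative[OF g]]
          Suc.IH[OF smooth_frechet_derivative[OF f] g]]
      by (auto simp: frechet_derivative_eq[OF D] differentiable_def)
  qed
  then show ?thesis by (simp add: smooth_on_def)
qed

lemma smooth_diff:
  assumes "smooth_on UNIV f" "smooth_on UNIV g"
  shows "smooth_on UNIV (\<lambda>x. f x - g x :: real)"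
proof -
  have "smooth_on UNIV (\<lambda>x. (-1) \<bullet> g x)"
    by (intro smooth_inner assms) (simp add: smooth_on_def Ck_on_const)
  then have "Ck_on r (\<lambda>x. f x + (-1) \<bullet> g x) UNIV" for r
    using assms(1) by (intro Ck_on_add) (auto simp: smooth_on_def)
  then show ?thesis by (simp add: smooth_on_def)
qed


section \<open>Symmetry of the second derivative\<close>

text \<open>The mean value theorem applies twice, first in the direction \<open>v\<close> to the increment of
  \<open>K\<close> along \<open>h *\<^sub>R w\<close>, then in the direction \<open>w\<close>. The left-hand side is symmetric in \<open>v\<close> and \<open>w\<close>,
  which the right-hand side is not.\<close>

lemma second_difference_mean_value:
  fixes K :: "'a::euclidean_space \<Rightarrow> real"
  assumes K: "smooth_on UNIV K" and "h > 0"
  obtains \<xi> \<eta> where "0 < \<xi>" "\<xi> < h" "0 < \<eta>" "\<eta> < h"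
    "K (x + h *\<^sub>R v + h *\<^sub>R w) - K (x + h *\<^sub>R v) - K (x + h *\<^sub>R w) + K x =
     h\<^sup>2 * frechet_derivative (\<lambda>y. frechet_derivative K (at y) v) (at (x + \<xi> *\<^sub>R v + \<eta> *\<^sub>R w)) w"
proof -
  let ?D = "\<lambda>y. frechet_derivative K (at y) v"
  have line: "((\<lambda>s. g (c + s *\<^sub>R d)) has_real_derivative frechet_derivative g (at (c + s *\<^sub>R d)) d) (at s)"
    if "smooth_on UNIV g" for g :: "'a \<Rightarrow> real" and c d s
  proof -
    have "((\<lambda>s. c + s *\<^sub>R d) has_derivative (\<lambda>t. t *\<^sub>R d)) (at s)"
      by (auto intro!: derivative_eq_intros)
    from has_derivative_compose[OF this smooth_has_derivative[OF that]]
    show ?thesis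
      using linear_frechet_derivative[OF that]
      by (simp add: has_field_derivative_def linear_scale mult_commute_abs)
  qed
  let ?\<phi> = "\<lambda>s. K ((x + h *\<^sub>R w) + s *\<^sub>R v) - K (x + s *\<^sub>R v)"
  have "(?\<phi> has_real_derivative ?D ((x + h *\<^sub>R w) + s *\<^sub>R v) - ?D (x + s *\<^sub>R v)) (at s)" for s
    by (intro DERIV_diff line K)
  then obtain \<xi> where \<xi>: "0 < \<xi>" "\<xi> < h"
      "?\<phi> h - ?\<phi> 0 = (h - 0) * (?D ((x + h *\<^sub>R w) + \<xi> *\<^sub>R v) - ?D (x + \<xi> *\<^sub>R v))"
    using MVT2[OF \<open>h > 0\<close>, of ?\<phi> "\<lambda>s. ?D ((x + h *\<^sub>R w) + s *\<^sub>R v) - ?D (x + s *\<^sub>R v)"] by blast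
  let ?\<psi> = "\<lambda>t. ?D ((x + \<xi> *\<^sub>R v) + t *\<^sub>R w)"
  have "(?\<psi> has_real_derivative
      frechet_derivative ?D (at ((x + \<xi> *\<^sub>R v) + t *\<^sub>R w)) w) (at t)" for t
    by (intro line smooth_frechet_derivative K)
  then obtain \<eta> where \<eta>: "0 < \<eta>" "\<eta> < h"
      "?\<psi> h - ?\<psi> 0 = (h - 0) * frechet_derivative ?D (at ((x + \<xi> *\<^sub>R v) + \<eta> *\<^sub>R w)) w"
    using MVT2[OF \<open>h > 0\<close>, of ?\<psi>
        "\<lambda>t. frechet_derivative ?D (at ((x + \<xi> *\<^sub>R v) + t *\<^sub>R w)) w"] by blast
  have "?\<phi> h - ?\<phi> 0 = h\<^sup>2 * frechet_derivative ?D (at (x + \<xi> *\<^sub>R v + \<eta> *\<^sub>R w)) w"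
    using \<xi>(3) \<eta>(3) by (simp add: power2_eq_square algebra_simps)
  then show thesis
    using that[OF \<xi>(1,2) \<eta>(1,2)] by (simp add: algebra_simps)
qed

text \<open>By the preceding lemma, applied to \<open>(v, w)\<close> and to \<open>(w, v)\<close>, the two mixed derivatives agree at
  suitable points arbitrarily close to \<open>x\<close>; continuity makes them agree at \<open>x\<close>.\<close>

lemma second_derivative_symmetric:
  fixes K :: "'a::euclidean_space \<Rightarrow> real"
  assumes K: "smooth_on UNIV K"
  shows "frechet_derivative (\<lambda>y. frechet_derivative K (at y) v) (at x) w =
         frechet_derivative (\<lambda>y. frechet_derivative K (at y) w) (at x) v"
proof -
  define B where "B v w y = frechet_derivative (\<lambda>y. frechet_derivative K (at y) v) (at y) w"
    for v w y
  define h where "h n = inverse (real (Suc n))" for n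
  have h: "h n > 0" for n by (simp add: h_def)
  have h0: "h \<longlonglongrightarrow> 0"
    unfolding h_def by (rule LIMSEQ_inverse_real_of_nat)
  have "\<exists>\<xi> \<eta> \<xi>' \<eta>'. \<xi> \<in> {0..h n} \<and> \<eta> \<in> {0..h n} \<and> \<xi>' \<in> {0..h n} \<and> \<eta>' \<in> {0..h n} \<and>
      B v w (x + \<xi> *\<^sub>R v + \<eta> *\<^sub>R w) = B w v (x + \<xi>' *\<^sub>R w + \<eta>' *\<^sub>R v)" for n
  proof -
    obtain \<xi> \<eta> where 1: "0 < \<xi>" "\<xi> < h n" "0 < \<eta>" "\<eta> < h n"
      "K (x + h n *\<^sub>R v + h n *\<^sub>R w) - K (x + h n *\<^sub>R v) - K (x + h n *\<^sub>R w) + K x =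
       (h n)\<^sup>2 * B v w (x + \<xi> *\<^sub>R v + \<eta> *\<^sub>R w)"
      unfolding B_def using second_difference_mean_value[OF K h] by metis
    obtain \<xi>' \<eta>' where 2: "0 < \<xi>'" "\<xi>' < h n" "0 < \<eta>'" "\<eta>' < h n"
      "K (x + h n *\<^sub>R w + h n *\<^sub>R v) - K (x + h n *\<^sub>R w) - K (x + h n *\<^sub>R v) + K x =
       (h n)\<^sup>2 * B w v (x + \<xi>' *\<^sub>R w + \<eta>' *\<^sub>R v)"
      unfolding B_def using second_difference_mean_value[OF K h] by metis
    have swap: "x + h n *\<^sub>R w + h n *\<^sub>R v = x + h n *\<^sub>R v + h n *\<^sub>R w"
      by (simp add: add_ac)
    have "(h n)\<^sup>2 * B v w (x + \<xi> *\<^sub>R v + \<eta> *\<^sub>R w) = (h n)\<^sup>2 * B w v (x + \<xi>' *\<^sub>R w + \<eta>' *\<^sub>R v)"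
      using 1(5) 2(5)[unfolded swap] by linarith
    then have "B v w (x + \<xi> *\<^sub>R v + \<eta> *\<^sub>R w) = B w v (x + \<xi>' *\<^sub>R w + \<eta>' *\<^sub>R v)"
      using h[of n] by simp
    with 1(1-4) 2(1-4) show ?thesis by (meson atLeastAtMost_iff less_imp_le)
  qed
  then obtain \<xi> \<eta> \<xi>' \<eta>' where *:
    "\<And>n. \<xi> n \<in> {0..h n}" "\<And>n. \<eta> n \<in> {0..h n}" "\<And>n. \<xi>' n \<in> {0..h n}" "\<And>n. \<eta>' n \<in> {0..h n}"
    "\<And>n. B v w (x + \<xi> n *\<^sub>R v + \<eta> n *\<^sub>R w) = B w v (x + \<xi>' n *\<^sub>R w + \<eta>' n *\<^sub>R v)"
    by metis
  have to0: "r \<longlonglongrightarrow> 0" if "\<And>n. r n \<in> {0..h n}" for r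
    using that by (intro tendsto_sandwich[OF _ _ tendsto_const h0]) auto
  have lim: "(\<lambda>n. B a b (x + r n *\<^sub>R a + s n *\<^sub>R b)) \<longlonglongrightarrow> B a b x"
    if "\<And>n. r n \<in> {0..h n}" "\<And>n. s n \<in> {0..h n}" for a b r s
  proof -
    have "isCont (B a b) x"
      unfolding B_def
      by (rule has_derivative_continuous[OF smooth_has_derivative])
        (intro smooth_frechet_derivative K)
    moreover have "(\<lambda>n. x + r n *\<^sub>R a + s n *\<^sub>R b) \<longlonglongrightarrow> x + 0 *\<^sub>R a + 0 *\<^sub>R b"
      by (intro tendsto_intros to0 that)
    ultimately show ?thesis by (intro isCont_tendsto_compose[where g = "B a b"]) auto
  qed
  have "B v w x = B w v x"
    using lim[OF *(1,2), of v w] lim[OF *(3,4), of w v] unfolding *(5) by (rule LIMSEQ_unique)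
  then show ?thesis by (simp add: B_def)
qed


section \<open>Gradients and Hessians\<close>

lemma linear_axis_expansion:
  fixes A :: "real^'i::finite \<Rightarrow> real"
  assumes "linear A"
  shows "A w = (\<Sum>i\<in>UNIV. w $ i * A (axis i 1))"
proof -
  have "A w = A (\<Sum>i\<in>UNIV. w $ i *s axis i 1)" by (simp add: basis_expansion)
  then show ?thesis
    by (simp add: linear_sum[OF assms] linear_scale[OF assms] scalar_mult_eq_scaleR)
qed

lemma grad_inner:
  assumes "smooth_on UNIV g"
  shows "grad g x \<bullet> w = frechet_derivative g (at x) w"
  using linear_axis_expansion[OF linear_frechet_derivative[OF assms], of x w]
  by (simp add: grad_def partial_def inner_vec_def mult.commute)

lemma hessian_mult_vec:
  assumes g: "smooth_on UNIV g"
  shows "(hessian g x *v c) $ a =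
         frechet_derivative (\<lambda>y. frechet_derivative g (at y) c) (at x) (axis a 1)"
proof -
  have "((\<lambda>y. \<Sum>b\<in>UNIV. c $ b * frechet_derivative g (at y) (axis b 1)) has_derivative
      (\<lambda>v. \<Sum>b\<in>UNIV. c $ b * frechet_derivative (\<lambda>y. frechet_derivative g (at y) (axis b 1)) (at x) v))
      (at x)"
    by (intro has_derivative_sum has_derivative_mult_right smooth_has_derivative
        smooth_frechet_derivative g)
  then have "((\<lambda>y. frechet_derivative g (at y) c) has_derivative
      (\<lambda>v. \<Sum>b\<in>UNIV. c $ b * frechet_derivative (\<lambda>y. frechet_derivative g (at y) (axis b 1)) (at x) v))
      (at x)"
    by (simp flip: linear_axis_expansion[OF linear_frechet_derivative[OF g]])
  then show ?thesis
    by (simp add: frechet_derivative_eq matrix_vector_mult_def hessian_def partial_def[abs_def]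
        mult.commute)
qed


section \<open>Zero sets of families of smooth functions\<close>

text \<open>A regular value theorem in dual form: \<open>G\<close> is a map into the dual of \<open>'b\<close>, and regularity at
  a zero says that no nonzero \<open>w\<close> is annihilated by its transposed derivative. By linearity in \<open>w\<close>,
  the functions \<open>G b\<close> with \<open>b\<close> in a basis are defining functions, and a relation with
  coefficients \<open>a\<^sub>b\<close> between their differentials is the vanishing of the differential of \<open>G w\<close>
  for \<open>w = \<Sum> a\<^sub>b b\<close>.\<close>

lemma smooth_submanifold_zero_set:
  fixes G :: "'b::euclidean_space \<Rightarrow> 'a::euclidean_space \<Rightarrow> real"
  assumes lin: "\<And>x. linear (\<lambda>w. G w x)"
    and sm: "\<And>w. smooth_on UNIV (G w)"
    and reg: "\<And>x w. \<forall>w. G w x = 0 \<Longrightarrow> (\<And>v. ext_d (G w) x v = 0) \<Longrightarrow> w = 0"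
    and dim: "d + DIM('b) = DIM('a)"
  shows "smooth_submanifold d {x. \<forall>w. G w x = 0}"
proof -
  obtain e :: "nat \<Rightarrow> 'b" where e: "bij_betw e {..<DIM('b)} Basis"
    using ex_bij_betw_nat_finite[OF finite_Basis] by (auto simp: atLeast0LessThan)
  have zero: "(\<forall>i<DIM('b). G (e i) x = 0) \<longleftrightarrow> (\<forall>w. G w x = 0)" for x
  proof
    assume "\<forall>i<DIM('b). G (e i) x = 0"
    then have "G b x = 0" if "b \<in> Basis" for b
      using e that by (metis bij_betw_iff_bijections lessThan_iff)
    then show "\<forall>w. G w x = 0"
      using linear_eq_0_on_span[OF lin, of Basis] by simp
  qed auto
  have indep: "\<forall>i<DIM('b). a i = 0"
    if x: "\<forall>w. G w x = 0" and a: "\<forall>v. (\<Sum>i<DIM('b). a i * ext_d (G (e i)) x v) = 0"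
    for x and a :: "nat \<Rightarrow> real"
  proof -
    define w where "w = (\<Sum>i<DIM('b). a i *\<^sub>R e i)"
    have "G w = (\<lambda>y. \<Sum>i<DIM('b). a i * G (e i) y)"
      by (simp add: fun_eq_iff w_def linear_sum[OF lin] linear_scale[OF lin])
    moreover have "((\<lambda>y. \<Sum>i<DIM('b). a i * G (e i) y) has_derivative
        (\<lambda>v. \<Sum>i<DIM('b). a i * frechet_derivative (G (e i)) (at x) v)) (at x)"
      by (intro has_derivative_sum has_derivative_mult_right smooth_has_derivative sm)
    ultimately have "frechet_derivative (G w) (at x) =
        (\<lambda>v. \<Sum>i<DIM('b). a i * frechet_derivative (G (e i)) (at x) v)"
      by (simp add: frechet_derivative_eq)
    then have "ext_d (G w) x v = 0" for v
      using a by (simp add: ext_d_def)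
    then have "w = 0" using reg x by blast
    show ?thesis
    proof (intro allI impI)
      fix j assume j: "j < DIM('b)"
      have "e i \<bullet> e j = (if i = j then 1 else 0)" if "i < DIM('b)" for i
      proof -
        have "e i \<in> Basis" "e j \<in> Basis" "e i = e j \<longleftrightarrow> i = j"
          using e that j by (auto simp: bij_betw_def inj_on_def)
        then show ?thesis by (simp add: inner_Basis)
      qed
      then have "w \<bullet> e j = (\<Sum>i<DIM('b). if i = j then a i else 0)"
        unfolding w_def inner_sum_left by (intro sum.cong) auto
      also have "\<dots> = a j" using j by simp
      finally show "a j = 0" using \<open>w = 0\<close> by simp
    qed
  qed
  show ?thesis
    unfolding smooth_submanifold_def
  proof (intro exI[of _ "DIM('b)"] conjI ballI dim)
    fix x :: 'a assume "x \<in> {x. \<forall>w. G w x = 0}"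
    show "\<exists>U g. open U \<and> x \<in> U \<and> (\<forall>i<DIM('b). smooth_on U (g i)) \<and>
        {x. \<forall>w. G w x = 0} \<inter> U = {y \<in> U. \<forall>i<DIM('b). g i y = 0} \<and>
        (\<forall>y\<in>{x. \<forall>w. G w x = 0} \<inter> U. \<forall>a. (\<forall>v. (\<Sum>i<DIM('b). a i * ext_d (g i) y v) = 0) \<longrightarrow>
          (\<forall>i<DIM('b). a i = 0))"
      by (intro exI[of _ UNIV] exI[of _ "\<lambda>i. G (e i)"]) (use indep in \<open>auto simp: sm zero\<close>)
  qed
qed

lemma ext_d_tangent_vector:
  assumes v: "v \<in> tangent_vectors M x" and g: "smooth_on UNIV g" and zero: "\<And>y. y \<in> M \<Longrightarrow> g y = 0"
  shows "ext_d g x v = 0"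
proof -
  obtain e \<gamma> where e: "e > 0" "\<gamma> ` {-e<..<e} \<subseteq> M" and \<gamma>: "\<gamma> 0 = x"
      "(\<gamma> has_vector_derivative v) (at (0::real))"
    using v by (auto simp: tangent_vectors_def)
  have "((\<lambda>t. g (\<gamma> t)) has_derivative (\<lambda>t. frechet_derivative g (at x) (t *\<^sub>R v))) (at 0)"
    using has_derivative_compose[OF \<gamma>(2)[unfolded has_vector_derivative_def]
        smooth_has_derivative[OF g]] \<gamma>(1) by simp
  moreover have "((\<lambda>t. g (\<gamma> t)) has_derivative (\<lambda>t. 0)) (at 0)"
    by (rule has_derivative_transform_within_open[of "\<lambda>_. 0" _ _ _ "{-e<..<e}"])
      (use e zero in \<open>auto simp: image_subset_iff\<close>)
  ultimately have "(\<lambda>t. frechet_derivative g (at x) (t *\<^sub>R v)) = (\<lambda>t. 0)"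
    by (rule has_derivative_unique)
  then show ?thesis by (metis ext_d_def scaleR_one)
qed


section \<open>The solution set\<close>

definition hamiltonian_args :: "('n::finite, 'm::finite) point \<Rightarrow> (real^'n) \<times> (real^'n) \<times> (real^'m)" where
  "hamiltonian_args X = (q_now X, p_next X, fst (snd (snd X)))"

text \<open>The three equations paired with a test vector \<open>w\<close>, which has the shape of an argument of \<open>K\<close>:
  the \<open>q\<close> slot tests the equation for \<open>p\<close>, the \<open>p'\<close> slot the one for \<open>q'\<close>, and the \<open>u\<close> slot
  stationarity in \<open>u\<close>. Keeping \<open>w\<close> arbitrary, not a coordinate vector, allows it to
  be the \<open>(q, p', u)\<close> part of a second tangent vector.\<close>

definition defect ::
  "((real^'n::finite) \<times> (real^'n) \<times> (real^'m::finite) \<Rightarrow> real) \<Rightarrow>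
   (real^'n) \<times> (real^'n) \<times> (real^'m) \<Rightarrow> ('n, 'm) point \<Rightarrow> real" where
  "defect K w X =
     (p_now X \<bullet> fst w + q_next X \<bullet> fst (snd w)) - frechet_derivative K (at (hamiltonian_args X)) w"

lemma bounded_linear_coords:
  "bounded_linear q_now" "bounded_linear p_now" "bounded_linear q_next" "bounded_linear p_next"
  "bounded_linear hamiltonian_args"
proof -
  have eq: "q_now = (\<lambda>X. fst X)" "p_now = (\<lambda>X. fst (snd X))" "q_next = (\<lambda>X. fst (snd (snd (snd X))))"
    "p_next = (\<lambda>X. snd (snd (snd (snd X))))"
    by (auto simp: q_now_def p_now_def q_next_def p_next_def)
  show "bounded_linear q_now" "bounded_linear p_now" "bounded_linear q_next" "bounded_linear p_next"
    unfolding eq by (intro bounded_linear_intros)+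
  show "bounded_linear hamiltonian_args"
    unfolding hamiltonian_args_def[abs_def] eq by (intro bounded_linear_intros)
qed

lemma d_wedge_d_linear:
  fixes P Q :: "'a::euclidean_space \<Rightarrow> real^'n::finite"
  assumes "bounded_linear P" "bounded_linear Q"
  shows "d_wedge_d P Q x v w = P v \<bullet> Q w - P w \<bullet> Q v"
proof -
  have "ext_d (\<lambda>y. A y $ i) x v = A v $ i" if "bounded_linear A" for A :: "'a \<Rightarrow> real^'n" and i v
    unfolding ext_d_def
    by (subst frechet_derivative_eq[OF bounded_linear_imp_has_derivative])
      (auto intro: bounded_linear_compose[OF bounded_linear_vec_nth that])
  then show ?thesis
    using assms by (simp add: d_wedge_d_def wedge_def inner_vec_def sum_subtractf)
qed

lemma smooth_defect:
  assumes K: "smooth_on UNIV K"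
  shows "smooth_on UNIV (defect K w)"
  unfolding defect_def[abs_def]
  by (intro smooth_diff smooth_bounded_linear bounded_linear_add
      bounded_linear_compose[OF bounded_linear_inner_left] bounded_linear_coords
      smooth_compose_linear[OF bounded_linear_coords(5)] smooth_frechet_derivative K)

lemma ext_d_defect:
  assumes K: "smooth_on UNIV K"
  shows "ext_d (defect K w) X V = p_now V \<bullet> fst w + q_next V \<bullet> fst (snd w) -
    frechet_derivative (\<lambda>z. frechet_derivative K (at z) w) (at (hamiltonian_args X)) (hamiltonian_args V)"
proof -
  have "(defect K w has_derivative (\<lambda>V. p_now V \<bullet> fst w + q_next V \<bullet> fst (snd w) -
    frechet_derivative (\<lambda>z. frechet_derivative K (at z) w) (at (hamiltonian_args X)) (hamiltonian_args V))) (at X)"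
    unfolding defect_def[abs_def]
    by (intro has_derivative_diff bounded_linear_imp_has_derivative bounded_linear_add
        bounded_linear_compose[OF bounded_linear_inner_left] bounded_linear_coords
        has_derivative_compose[OF bounded_linear_imp_has_derivative[OF bounded_linear_coords(5)]]
        smooth_has_derivative smooth_frechet_derivative K)
  then show ?thesis by (simp add: ext_d_def frechet_derivative_eq)
qed

text \<open>The partial gradients of \<open>K\<close> are the restrictions of its total derivative to the three
  factors, and a linear functional vanishes iff its restrictions do.\<close>

lemma solution_set_eq:
  fixes H :: "nat \<Rightarrow> real^'n::finite \<Rightarrow> real^'n \<Rightarrow> real^'m::finite \<Rightarrow> real"
  assumes K: "smooth_on UNIV (\<lambda>(q, p', u). H k q p' u)" (is "smooth_on UNIV ?K")
  shows "solution_set H k = {X. \<forall>w. defect ?K w X = 0}"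
proof -
  have "(q' = grad (\<lambda>y. H k q y u) p' \<and> p = grad (\<lambda>y. H k y p' u) q \<and> 0 = grad (\<lambda>y. H k q p' y) u)
      \<longleftrightarrow> (\<forall>w. defect ?K w (q, p, u, q', p') = 0)" (is "?L \<longleftrightarrow> ?R") for q p u q' p'
  proof -
    let ?D = "frechet_derivative ?K (at (q, p', u))"
    have grad: "grad (\<lambda>y. ?K (c + A y)) x \<bullet> w = frechet_derivative ?K (at (c + A x)) (A w)"
      if A: "bounded_linear A" for c x w and A :: "real^'i::finite \<Rightarrow> _"
      by (simp only: grad_inner[OF smooth_compose_affine[OF A K]]
          frechet_derivative_compose_affine(2)[OF A K])
    have inj: "bounded_linear (\<lambda>y::real^'n. (y, 0::real^'n, 0::real^'m))"
      "bounded_linear (\<lambda>y::real^'n. (0::real^'n, y, 0::real^'m))"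
      "bounded_linear (\<lambda>y::real^'m. (0::real^'n, 0::real^'n, y))"
      by (intro bounded_linear_intros)+
    have gq: "grad (\<lambda>y. H k y p' u) q \<bullet> w = ?D (w, 0, 0)" for w
      using grad[of "\<lambda>y. (y, 0, 0)" "(0, p', u)" q w] inj(1) by simp
    have gp: "grad (\<lambda>y. H k q y u) p' \<bullet> w = ?D (0, w, 0)" for w
      using grad[of "\<lambda>y. (0, y, 0)" "(q, 0, u)" p' w] inj(2) by simp
    have gu: "grad (\<lambda>y. H k q p' y) u \<bullet> w = ?D (0, 0, w)" for w
      using grad[of "\<lambda>y. (0, 0, y)" "(q, p', 0)" u w] inj(3) by simp
    have split: "?D (a, b, c) = ?D (a, 0, 0) + ?D (0, b, 0) + ?D (0, 0, c)" for a b c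
      by (simp flip: linear_add[OF linear_frechet_derivative[OF K]])
    have defect: "defect ?K (a, b, c) (q, p, u, q', p') =
        (p \<bullet> a - grad (\<lambda>y. H k y p' u) q \<bullet> a) + (q' \<bullet> b - grad (\<lambda>y. H k q y u) p' \<bullet> b)
        - grad (\<lambda>y. H k q p' y) u \<bullet> c" for a b c
      unfolding gq gp gu using split[of a b c]
      by (simp add: defect_def hamiltonian_args_def q_now_def p_now_def q_next_def p_next_def)
    show ?thesis
    proof
      assume ?L
      then have "defect ?K (a, b, c) (q, p, u, q', p') = 0" for a b c
        unfolding defect by simp
      then show ?R by (simp only: split_paired_All) blast
    next
      assume R: ?R
      have "p \<bullet> a = grad (\<lambda>y. H k y p' u) q \<bullet> a" for a
        using defect[of a 0 0] R by simp
      then have p: "p = grad (\<lambda>y. H k y p' u) q"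
        using vector_eq_rdot by blast
      have "q' \<bullet> b = grad (\<lambda>y. H k q y u) p' \<bullet> b" for b
        using defect[of 0 b 0] R by simp
      then have q': "q' = grad (\<lambda>y. H k q y u) p'"
        using vector_eq_rdot by blast
      have "0 \<bullet> c = grad (\<lambda>y. H k q p' y) u \<bullet> c" for c
        using defect[of 0 0 c] R by simp
      then have u: "0 = grad (\<lambda>y. H k q p' y) u"
        using vector_eq_rdot by blast
      show ?L
        by (intro conjI p q' u)
    qed
  qed
  then show ?thesis
    unfolding solution_set_def set_eq_iff split_paired_All mem_Collect_eq prod.case by blast
qed

text \<open>If the differential of \<open>defect K (a, b, c)\<close> vanishes, then testing it on the vectors with only
  a \<open>p\<close> or only a \<open>q'\<close> component gives \<open>a = 0\<close> and \<open>b = 0\<close>; testing it on those with only a \<open>u\<close>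
  component then says that \<open>c\<close> is in the kernel of the Hessian.\<close>

lemma smooth_submanifold_solution_set:
  fixes H :: "nat \<Rightarrow> real^'n::finite \<Rightarrow> real^'n \<Rightarrow> real^'m::finite \<Rightarrow> real"
  assumes K: "smooth_on UNIV (\<lambda>(q, p', u). H k q p' u)" (is "smooth_on UNIV ?K")
    and det: "\<And>q p' u. det (hessian (\<lambda>y. H k q p' y) u) \<noteq> 0"
  shows "smooth_submanifold (2 * CARD('n)) (solution_set H k)"
  unfolding solution_set_eq[of H k, OF K]
proof (rule smooth_submanifold_zero_set)
  show "linear (\<lambda>w. defect ?K w X)" for X
    using linear_frechet_derivative[OF K]
    by (auto simp: linear_iff defect_def algebra_simps)
  show "smooth_on UNIV (defect ?K w)" for w
    by (rule smooth_defect[OF K])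
  show "2 * CARD('n) + DIM((real^'n) \<times> (real^'n) \<times> (real^'m)) = DIM(('n, 'm) point)"
    by simp
  fix X :: "('n, 'm) point" and w :: "(real^'n) \<times> (real^'n) \<times> (real^'m)"
  assume ann: "\<And>V. ext_d (defect ?K w) X V = 0"
  obtain a b c where w: "w = (a, b, c)" by (metis prod_cases3)
  obtain q p u q' p' where X: "X = (q, p, u, q', p')" by (metis prod_cases5)
  have lin: "linear (frechet_derivative (\<lambda>z. frechet_derivative ?K (at z) w) (at z))" for z
    by (intro linear_frechet_derivative smooth_frechet_derivative K)
  note coords = hamiltonian_args_def q_now_def p_now_def q_next_def p_next_def
  have "a = 0"
    using ann[of "(0, a, 0, 0, 0)"] linear_0[OF lin, unfolded zero_prod_def]
    by (simp add: ext_d_defect[OF K] coords w)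
  moreover have "b = 0"
    using ann[of "(0, 0, 0, b, 0)"] linear_0[OF lin, unfolded zero_prod_def]
    by (simp add: ext_d_defect[OF K] coords w)
  moreover have "c = 0"
  proof -
    \<comment> \<open>The \<open>u\<close> slice of the Hamiltonian, as composition with an affine map.\<close>
    let ?A = "\<lambda>y::real^'m. (0::real^'n, 0::real^'n, y)" and ?z = "(q, p', 0::real^'m)"
    have A: "bounded_linear ?A" by (intro bounded_linear_intros)
    have "(hessian (\<lambda>y. ?K (?z + ?A y)) u *v c) $ i = 0" for i
    proof -
      have "(hessian (\<lambda>y. ?K (?z + ?A y)) u *v c) $ i =
          frechet_derivative (\<lambda>y. frechet_derivative ?K (at (?z + ?A y)) (?A c)) (at u) (axis i 1)"
        by (simp only: hessian_mult_vec[OF smooth_compose_affine[OF A K]]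
            frechet_derivative_compose_affine(2)[OF A K])
      also have "\<dots> = frechet_derivative (\<lambda>z. frechet_derivative ?K (at z) (?A c))
          (at (?z + ?A u)) (?A (axis i 1))"
        by (rule frechet_derivative_compose_affine(2)[OF A smooth_frechet_derivative[OF K]])
      also have "\<dots> = 0"
        using ann[of "(0, 0, axis i 1, 0, 0)"] \<open>a = 0\<close> \<open>b = 0\<close>
        by (simp add: ext_d_defect[OF K] coords w X)
      finally show ?thesis .
    qed
    then have "hessian (\<lambda>y. H k q p' y) u *v c = 0"
      by (simp add: vec_eq_iff)
    then show ?thesis
      using det[of q p' u] by (metis invertible_det_nz invertible_left_inverse matrix_left_invertible_ker)
  qed
  ultimately show "w = 0" by (simp add: w zero_prod_def)
qed

text \<open>Differentiating the equation \<open>defect K w = 0\<close> along \<open>V\<close>, with \<open>w\<close> taken from \<open>W\<close>, expresses the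
  second derivative of \<open>K\<close> by the components of \<open>V\<close> and \<open>W\<close>; exchanging \<open>V\<close> and
  \<open>W\<close> changes that expression by the difference of the two 2-forms.\<close>

lemma d_wedge_d_solution_set:
  fixes H :: "nat \<Rightarrow> real^'n::finite \<Rightarrow> real^'n \<Rightarrow> real^'m::finite \<Rightarrow> real"
  assumes K: "smooth_on UNIV (\<lambda>(q, p', u). H k q p' u)" (is "smooth_on UNIV ?K")
    and V: "V \<in> tangent_vectors (solution_set H k) X"
    and W: "W \<in> tangent_vectors (solution_set H k) X"
  shows "d_wedge_d p_now q_now X V W = d_wedge_d p_next q_next X V W"
proof -
  let ?B = "\<lambda>v w. frechet_derivative (\<lambda>z. frechet_derivative ?K (at z) w) (at (hamiltonian_args X)) v"
  have B: "?B (hamiltonian_args V) (hamiltonian_args W) = p_now V \<bullet> q_now W + q_next V \<bullet> p_next W"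
    if V: "V \<in> tangent_vectors (solution_set H k) X" for V W
  proof -
    have "ext_d (defect ?K (hamiltonian_args W)) X V = 0"
      by (rule ext_d_tangent_vector[OF V smooth_defect[OF K]]) (simp only: solution_set_eq[of H k, OF K] mem_Collect_eq)
    moreover have "fst (hamiltonian_args W) = q_now W" "fst (snd (hamiltonian_args W)) = p_next W"
      by (simp_all add: hamiltonian_args_def)
    ultimately show ?thesis by (simp add: ext_d_defect[OF K])
  qed
  have "p_now V \<bullet> q_now W + q_next V \<bullet> p_next W = p_now W \<bullet> q_now V + q_next W \<bullet> p_next V"
    unfolding B[OF V, symmetric] B[OF W, symmetric] by (rule second_derivative_symmetric[OF K])
  then show ?thesis
    by (simp add: d_wedge_d_linear bounded_linear_coords inner_commute)
qed

lemma smooth_Hbar: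
  assumes f: "smooth_on UNIV (\<lambda>(q, u). f k q u)" and L: "smooth_on UNIV (\<lambda>(q, u). L k q u)"
  shows "smooth_on UNIV (\<lambda>(q, p', u). Hbar f L k q p' u)"
proof -
  let ?A = "\<lambda>z. (fst z, snd (snd z))"
  have A: "bounded_linear ?A" by (intro bounded_linear_intros)
  have P: "bounded_linear (\<lambda>z. fst (snd z))" by (intro bounded_linear_intros)
  show ?thesis
    using smooth_diff[OF smooth_inner[OF smooth_bounded_linear[OF P] smooth_compose_linear[OF A f]]
        smooth_compose_linear[OF A L]]
    by (simp add: Hbar_def case_prod_beta')
qed

theorem mainTheorem5:
  fixes N :: nat
    and f :: "nat \<Rightarrow> real^'n::finite \<Rightarrow> real^'m::finite \<Rightarrow> real^'n"
    and L :: "nat \<Rightarrow> real^'n \<Rightarrow> real^'m \<Rightarrow> real"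
  assumes "N \<ge> 1"
    and "\<And>k. k < N \<Longrightarrow> smooth_on UNIV (\<lambda>(q, u). f k q u)"
    and "\<And>k. k < N \<Longrightarrow> smooth_on UNIV (\<lambda>(q, u). L k q u)"
    and "\<And>k q p' u. k < N \<Longrightarrow> det (hessian (\<lambda>y. Hbar f L k q p' y) u) \<noteq> 0"
  shows "\<forall>k<N. smooth_submanifold (2 * CARD('n)) (solution_set (Hbar f L) k) \<and>
           pullback_to (solution_set (Hbar f L) k) (d_wedge_d p_now q_now) =
           pullback_to (solution_set (Hbar f L) k) (d_wedge_d p_next q_next)"
proof (intro allI impI conjI)
  fix k assume k: "k < N"
  note K = smooth_Hbar[of f k L, OF assms(2)[OF k] assms(3)[OF k]]
  show "smooth_submanifold (2 * CARD('n)) (solution_set (Hbar f L) k)"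
    by (rule smooth_submanifold_solution_set[of "Hbar f L" k, OF K assms(4)[OF k]])
  show "pullback_to (solution_set (Hbar f L) k) (d_wedge_d p_now q_now) =
        pullback_to (solution_set (Hbar f L) k) (d_wedge_d p_next q_next)"
    unfolding pullback_to_def by (intro restrict_ext d_wedge_d_solution_set[of "Hbar f L" k, OF K])
qed

end
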